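(* Let $\alpha>0$. For every $\varepsilon>0$ there exist a function $f^*\in B\mathcal S_{\mathbf M}$ and a number $n_0$ such that for all $n>n_0$, $$\omega_\alpha\Big(f^*,\frac{\pi}{\lambda_n}\Big)_{\mathbf M}>\frac{\pi^\alpha-\varepsilon}{\lambda_n^\alpha}\sum_{\nu=1}^n(\lambda_\nu^\alpha-\lambda_{\nu-1}^\alpha)E_{\lambda_\nu}(f^* )_{\mathbf M}.$$
   Context: Almost periodic functions. A locally Lebesgue integrable $f:\mathbb R\to\mathbb C$ is called $B$-a.p. (Besicovitch almost periodic of order 1) if there are trigonometric sums $\tau_N(x)=\sum_{k} a_k e^{i\mu_k x}$ (finite sums, $\mu_k\in\mathbb R$, $a_k\in\mathbb C$) with $\limsup_{T\to\infty}\frac1{2T}\int_{-T}^T|f-\tau_N|\,dx\to0$ as $N\to\infty$. For such $f$ the mean value $A\{f\}=\lim_{T\to\infty}\frac1T\int_0^Tf(x)\,dx$ exists, and the Fourier exponents of $f$ are the (at most countably many) $\lambda\in\mathbb R$ with $A\{f(\cdot)e^{-i\lambda\cdot}\}\ne0$. Exponents. $\{\lambda_k\}_{k\in\mathbb Z}$ is a fixed real sequence with $\lambda_0=0$, $\lambda_{-k}=-\lambda_k$, $0<\lambda_k<\lambda_{k+1}$ for $k\ge1$, and $\lambda_k\to\infty$ as $k\to\infty$. All functions considered are $B$-a.p. with all Fourier exponents in $\{\lambda_k\}_{k\in\mathbb Z}$ (some coefficients may vanish); put $A_k(f)=A\{f(\cdot)e^{-i\lambda_k\cdot}\}$. The space.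 $\mathbf M=\{M_k\}_{k\in\mathbb Z}$ is a sequence of Orlicz functions: each $M_k:[0,\infty)\to[0,\infty)$ is nondecreasing and convex, $M_k(0)=0$, $M_k(t)\to\infty$ as $t\to\infty$. Let $M_k^*(v)=\sup\{uv-M_k(u):u\ge0\}$, and let $\Gamma$ be the set of sequences of positive numbers $\gamma=\{\gamma_k\}_{k\in\mathbb Z}$ with $\sum_{k\in\mathbb Z}M_k^*(\gamma_k)\le1$. The space $B\mathcal S_{\mathbf M}$ consists of those functions $f$ for which $\|f\|_{\mathbf M}:=\sup\{\sum_{k\in\mathbb Z}\gamma_k|A_k(f)|:\gamma\in\Gamma\}<\infty$; functions with the same Fourier series are identified. Best approximation. $E_{\lambda_n}(f)_{\mathbf M}=\inf\|f-g\|_{\mathbf M}$, the infimum over all $g$ whose Fourier exponents lie in the interval $(-\lambda_n,\lambda_n)$. Modulus of smoothness of order $\alpha>0$. With $\varphi_\alpha(t)=2^{\alpha/2}(1-\cos t)^{\alpha/2}=2^\alpha|\sin(t/2)|^\alpha$, for $\delta\ge0$, $$\omega_\alpha(f,\delta)_{\mathbf M}=\sup_{|h|\le\delta}\ \sup\Big\{\sum_{k\in\mathbb Z}\gamma_k\varphi_\alpha(\lambda_kh)|A_k(f)|:\gamma\in\Gamma\Big\}.$$ *)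

theory Defs
  imports "HOL-Analysis.Analysis"
begin

section \<open>Besicovitch almost periodic functions\<close>

definition trig_sum :: "(real \<Rightarrow> complex) \<Rightarrow> bool" where
  "trig_sum \<tau> \<longleftrightarrow>
     (\<exists>S a. finite S \<and> \<tau> = (\<lambda>x. \<Sum>\<mu>\<in>S. a \<mu> * exp (\<i> * complex_of_real (\<mu> * x))))"

definition locally_integrable :: "(real \<Rightarrow> complex) \<Rightarrow> bool" where
  "locally_integrable f \<longleftrightarrow> (\<forall>a b. set_integrable lebesgue {a..b} f)"

definition besicovitch_dist :: "(real \<Rightarrow> complex) \<Rightarrow> (real \<Rightarrow> complex) \<Rightarrow> ereal" where
  "besicovitch_dist f g =
     Limsup at_top (\<lambda>T::real. ereal (1 / (2 * T) * (LINT x:{-T..T}|lebesgue. cmod (f x - g x))))"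

definition B_ap :: "(real \<Rightarrow> complex) \<Rightarrow> bool" where
  "B_ap f \<longleftrightarrow> locally_integrable f \<and>
     (\<exists>\<tau>. (\<forall>N::nat. trig_sum (\<tau> N)) \<and> (\<lambda>N. besicovitch_dist f (\<tau> N)) \<longlonglongrightarrow> 0)"

text \<open>The limit defining the mean value exists for every B-a.p. function;
  for other functions the value is unspecified.\<close>

definition mean_value :: "(real \<Rightarrow> complex) \<Rightarrow> complex" where
  "mean_value f = Lim at_top (\<lambda>T::real. complex_of_real (1 / T) * (LINT x:{0..T}|lebesgue. f x))"

definition fourier_coeff :: "(real \<Rightarrow> complex) \<Rightarrow> real \<Rightarrow> complex" where
  "fourier_coeff f l = mean_value (\<lambda>x. f x * exp (- \<i> * complex_of_real (l * x)))"

definition fourier_exponents :: "(real \<Rightarrow> complex) \<Rightarrow> real set" where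
  "fourier_exponents f = {l. fourier_coeff f l \<noteq> 0}"

definition exponent_sequence :: "(int \<Rightarrow> real) \<Rightarrow> bool" where
  "exponent_sequence lam \<longleftrightarrow>
     lam 0 = 0 \<and> (\<forall>k. lam (- k) = - lam k) \<and>
     (\<forall>k\<ge>1. 0 < lam k \<and> lam k < lam (k + 1)) \<and> filterlim lam at_top at_top"

definition B_ap_space :: "(int \<Rightarrow> real) \<Rightarrow> (real \<Rightarrow> complex) set" where
  "B_ap_space lam = {f. B_ap f \<and> fourier_exponents f \<subseteq> range lam}"

section \<open>Orlicz functions and the space $B\mathcal S_{\mathbf M}$\<close>

text \<open>An Orlicz function lives on $[0,\infty)$; its values at negative arguments are irrelevant.\<close>

definition orlicz_function :: "(real \<Rightarrow> real) \<Rightarrow> bool" where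
  "orlicz_function \<Phi> \<longleftrightarrow>
     (\<forall>t\<ge>0. 0 \<le> \<Phi> t) \<and> mono_on {0..} \<Phi> \<and> convex_on {0..} \<Phi> \<and> \<Phi> 0 = 0 \<and>
     filterlim \<Phi> at_top at_top"

text \<open>Suprema and sums of nonnegative terms are taken in the extended reals, because the conjugate
  function and the norm can be infinite.\<close>

definition orlicz_conj :: "(real \<Rightarrow> real) \<Rightarrow> real \<Rightarrow> ereal" where
  "orlicz_conj \<Phi> v = (SUP u\<in>{0..}. ereal (u * v - \<Phi> u))"

definition Gamma_set :: "(int \<Rightarrow> real \<Rightarrow> real) \<Rightarrow> (int \<Rightarrow> real) set" where
  "Gamma_set M = {\<gamma>. (\<forall>k. 0 < \<gamma> k) \<and> (\<Sum>\<^sub>\<infinity>k. orlicz_conj (M k) (\<gamma> k)) \<le> 1}"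

definition BS_norm ::
    "(int \<Rightarrow> real) \<Rightarrow> (int \<Rightarrow> real \<Rightarrow> real) \<Rightarrow> (real \<Rightarrow> complex) \<Rightarrow> ereal" where
  "BS_norm lam M f =
     (SUP \<gamma>\<in>Gamma_set M. \<Sum>\<^sub>\<infinity>k. ereal (\<gamma> k * cmod (fourier_coeff f (lam k))))"

text \<open>Functions with the same Fourier series are represented by any of their members; the norm,
  the best approximation and the modulus below depend on the Fourier coefficients only.\<close>

definition BS_space :: "(int \<Rightarrow> real) \<Rightarrow> (int \<Rightarrow> real \<Rightarrow> real) \<Rightarrow> (real \<Rightarrow> complex) set" where
  "BS_space lam M = {f \<in> B_ap_space lam. BS_norm lam M f < \<infinity>}"

definition best_approx ::
    "(int \<Rightarrow> real) \<Rightarrow> (int \<Rightarrow> real \<Rightarrow> real) \<Rightarrow> real \<Rightarrow> (real \<Rightarrow> complex) \<Rightarrow> ereal" where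
  "best_approx lam M \<sigma> f =
     (INF g\<in>{g \<in> B_ap_space lam. fourier_exponents g \<subseteq> {-\<sigma><..<\<sigma>}}.
        BS_norm lam M (\<lambda>x. f x - g x))"

definition phi :: "real \<Rightarrow> real \<Rightarrow> real" where
  "phi \<alpha> t = 2 powr (\<alpha> / 2) * (1 - cos t) powr (\<alpha> / 2)"

definition modulus ::
    "(int \<Rightarrow> real) \<Rightarrow> (int \<Rightarrow> real \<Rightarrow> real) \<Rightarrow> real \<Rightarrow> (real \<Rightarrow> complex) \<Rightarrow> real \<Rightarrow> ereal" where
  "modulus lam M \<alpha> f \<delta> =
     (SUP h\<in>{-\<delta>..\<delta>}. SUP \<gamma>\<in>Gamma_set M.
        \<Sum>\<^sub>\<infinity>k. ereal (\<gamma> k * phi \<alpha> (lam k * h) * cmod (fourier_coeff f (lam k))))"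

end

theory Submission
  imports Defs "HOL-Real_Asymp.Real_Asymp"
begin

text \<open>
  The extremal function can be taken independently of \<open>\<epsilon>\<close>: it is the single harmonic
  \<open>f x = exp (\<i> \<lambda>\<^sub>1 x)\<close>. Its only nonzero Fourier coefficient is \<open>A\<^sub>1(f) = 1\<close>, so that its norm is
  \<open>N = sup {\<gamma>\<^sub>1 | \<gamma> \<in> \<Gamma>}\<close>.

  This number is positive and finite. It is positive because \<open>\<Gamma>\<close> is nonempty: the conjugate of an
  Orlicz function is small near 0 (\<open>orlicz_conj_small\<close>), so positive weights \<open>\<gamma>\<^sub>k\<close> with
  \<open>\<Sum>\<^sub>k M\<^sub>k\<^sup>*(\<gamma>\<^sub>k) \<le> 1\<close> exist (\<open>Gamma_set_nonempty\<close>). It is finite because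
  \<open>M\<^sub>1\<^sup>*(\<gamma>\<^sub>1) \<le> 1\<close> forces \<open>\<gamma>\<^sub>1 \<le> 1 + M\<^sub>1(1)\<close> (\<open>Gamma_set_bounded\<close>).

  As soon as \<open>\<nu> \<ge> 2\<close>, the function \<open>f\<close> is itself an admissible approximant, and
  \<open>E\<^bsub>\<lambda>\<^sub>\<nu>\<^esub>(f) = 0\<close>; for \<open>\<nu> = 1\<close> the approximant 0 gives \<open>E\<^bsub>\<lambda>\<^sub>1\<^esub>(f) \<le> N\<close>. Hence the weighted sum
  of best approximations never exceeds \<open>\<lambda>\<^sub>1\<^sup>\<alpha> N\<close>. On the other side, the shift \<open>h = \<pi>/\<lambda>\<^sub>n\<close>
  gives \<open>\<omega>\<^sub>\<alpha>(f, \<pi>/\<lambda>\<^sub>n) \<ge> \<phi>\<^sub>\<alpha>(\<pi>\<lambda>\<^sub>1/\<lambda>\<^sub>n) N\<close>. Since \<open>\<phi>\<^sub>\<alpha>(t)\<close> is asymptotic to \<open>t\<^sup>\<alpha>\<close> at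
  \<open>0\<close> and \<open>\<lambda>\<^sub>n \<rightarrow> \<infinity>\<close>, this lower bound is asymptotic to \<open>\<pi>\<^sup>\<alpha> \<lambda>\<^sub>1\<^sup>\<alpha> N / \<lambda>\<^sub>n\<^sup>\<alpha>\<close>, which
  beats every smaller constant in place of \<open>\<pi>\<^sup>\<alpha>\<close> for large \<open>n\<close>.
\<close>

section \<open>Fourier coefficients of a single harmonic\<close>

lemma set_integrable_continuous_Icc:
  fixes f :: "real \<Rightarrow> complex"
  assumes "continuous_on UNIV f"
  shows "set_integrable lebesgue {a..b} f"
proof -
  have "set_integrable lborel {a..b} f"
    by (rule borel_integrable_atLeastAtMost') (rule continuous_on_subset[OF assms subset_UNIV])
  then show ?thesis
    unfolding set_integrable_def
    by (subst integrable_completion) (auto dest: borel_measurable_integrable)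
qed

lemma B_ap_harmonic: "B_ap (\<lambda>x. a * exp (\<i> * complex_of_real (\<mu> * x)))" (is "B_ap ?f")
proof -
  have "locally_integrable ?f"
    unfolding locally_integrable_def
    by (intro allI set_integrable_continuous_Icc continuous_intros)
  moreover have "trig_sum ?f"
    unfolding trig_sum_def by (rule exI[of _ "{\<mu>}"], rule exI[of _ "\<lambda>_. a"]) simp
  moreover have "besicovitch_dist ?f ?f = 0"
    by (simp add: besicovitch_dist_def Limsup_const set_lebesgue_integral_def zero_ereal_def)
  ultimately show ?thesis
    unfolding B_ap_def by (auto intro!: exI[of _ "\<lambda>_. ?f"])
qed

lemma mean_value_eqI:
  assumes "((\<lambda>T::real. complex_of_real (1 / T) * (LINT x:{0..T}|lebesgue. f x)) \<longlongrightarrow> m) at_top"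
  shows "mean_value f = m"
  unfolding mean_value_def using assms by (intro tendsto_Lim) auto

lemma mean_value_const: "mean_value (\<lambda>_. a) = a"
proof (rule mean_value_eqI, rule tendsto_eventually)
  show "\<forall>\<^sub>F T::real in at_top. complex_of_real (1 / T) * (LINT x:{0..T}|lebesgue. a) = a"
    using eventually_gt_at_top[of 0]
  proof eventually_elim
    case (elim T)
    have "(LINT x:{0..T}|lebesgue. a) = of_real T * a"
      using elim by (simp add: set_lebesgue_integral_def scaleR_conv_of_real)
    then show ?case using elim by simp
  qed
qed

text \<open>The integral of a nonconstant harmonic over \<open>[0, T]\<close> is bounded uniformly in \<open>T\<close>.\<close>

lemma mean_value_harmonic:
  assumes "c \<noteq> 0"
  shows "mean_value (\<lambda>x. a * exp (\<i> * complex_of_real (c * x))) = 0"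
proof (rule mean_value_eqI)
  let ?f = "\<lambda>x::real. a * exp (\<i> * complex_of_real (c * x))"
  let ?F = "\<lambda>x::real. a * exp (\<i> * complex_of_real (c * x)) / (\<i> * complex_of_real c)"
  have int: "(LINT x:{0..T}|lebesgue. ?f x) = ?F T - ?F 0" if "T > 0" for T
  proof -
    have "(?F has_vector_derivative ?f x) (at x within {0..T})" for x
    proof -
      have "((\<lambda>z. a * exp (\<i> * (of_real c * z)) / (\<i> * of_real c)) has_field_derivative ?f x)
        (at (complex_of_real x))"
        using assms by (auto intro!: derivative_eq_intros simp: field_simps)
      from has_vector_derivative_real_field[OF this] show ?thesis by simp
    qed
    then have "(?f has_integral (?F T - ?F 0)) {0..T}"
      using that by (intro fundamental_theorem_of_calculus) auto
    moreover have "set_integrable lebesgue {0..T} ?f"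
      by (intro set_integrable_continuous_Icc continuous_intros)
    ultimately show ?thesis
      by (simp only: set_lebesgue_integral_eq_integral integral_unique)
  qed
  have "((\<lambda>T. 2 * cmod a / \<bar>c\<bar> / T) \<longlongrightarrow> 0) at_top"
    by real_asymp
  moreover have "\<forall>\<^sub>F T in at_top.
    norm (complex_of_real (1 / T) * (LINT x:{0..T}|lebesgue. ?f x)) \<le> 2 * cmod a / \<bar>c\<bar> / T"
    using eventually_gt_at_top[of 0]
  proof eventually_elim
    case (elim T)
    have "norm (?F T - ?F 0) \<le> norm (?F T) + norm (?F 0)"
      by (rule norm_triangle_ineq4)
    also have "\<dots> = 2 * cmod a / \<bar>c\<bar>"
      by (simp add: norm_mult norm_divide)
    finally show ?case
      unfolding int[OF elim] norm_mult norm_of_real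
      using elim by (simp only: abs_divide abs_one abs_of_pos mult_1_left times_divide_eq_left
        divide_right_mono less_imp_le)
  qed
  ultimately show "((\<lambda>T. complex_of_real (1 / T) * (LINT x:{0..T}|lebesgue. ?f x)) \<longlongrightarrow> 0) at_top"
    by (rule Lim_null_comparison[rotated])
qed

lemma fourier_coeff_harmonic:
  "fourier_coeff (\<lambda>x. a * exp (\<i> * complex_of_real (\<mu> * x))) l = (if l = \<mu> then a else 0)"
proof -
  have "(\<lambda>x. a * exp (\<i> * complex_of_real (\<mu> * x)) * exp (- \<i> * complex_of_real (l * x)))
      = (\<lambda>x. a * exp (\<i> * complex_of_real ((\<mu> - l) * x)))"
    by (simp add: fun_eq_iff algebra_simps flip: exp_add)
  then show ?thesis
    using mean_value_harmonic[of "\<mu> - l" a] by (auto simp: fourier_coeff_def mean_value_const)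
qed

lemma fourier_coeff_zero: "fourier_coeff (\<lambda>_. 0) l = 0"
  using fourier_coeff_harmonic[of 0 0 l] by simp

section \<open>Orlicz functions and admissible weights\<close>

lemma orlicz_conj_nonneg:
  assumes "orlicz_function \<Phi>"
  shows "0 \<le> orlicz_conj \<Phi> v"
  unfolding orlicz_conj_def using assms
  by (intro SUP_upper2[of 0]) (auto simp: orlicz_function_def)

text \<open>
  Choose \<open>u\<^sub>0\<close> with \<open>\<Phi> u\<^sub>0 > 0\<close>. Beyond \<open>u\<^sub>0\<close>, convexity keeps \<open>\<Phi>\<close> above the line
  through the origin with slope \<open>\<Phi> u\<^sub>0 / u\<^sub>0\<close>. So for \<open>v\<close> at most this slope, only arguments in
  \<open>[0, u\<^sub>0]\<close> can give \<open>u v - \<Phi> u\<close> a positive value, and \<open>\<Phi>\<^sup>* v \<le> u\<^sub>0 v\<close>.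
\<close>

lemma orlicz_conj_small:
  assumes \<Phi>: "orlicz_function \<Phi>" and "w > 0"
  obtains v where "v > 0" "orlicz_conj \<Phi> v \<le> ereal w"
proof -
  from \<Phi> have "filterlim \<Phi> at_top at_top" by (simp add: orlicz_function_def)
  then have "\<forall>\<^sub>F u in at_top. \<Phi> u > 0 \<and> u > 0"
    using filterlim_at_top_dense eventually_gt_at_top eventually_conj by blast
  then obtain u0 where u0: "u0 > 0" "\<Phi> u0 > 0"
    by (auto simp: eventually_at_top_linorder)
  define v where "v = min (\<Phi> u0 / u0) (w / u0)"
  have "u * v - \<Phi> u \<le> w" if "u \<ge> 0" for u
  proof (cases "u \<le> u0")
    case True
    have "u * v \<le> u0 * (w / u0)"
      using True that u0 \<open>w > 0\<close> by (intro mult_mono) (auto simp: v_def)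
    moreover have "\<Phi> u \<ge> 0" using \<Phi> that by (simp add: orlicz_function_def)
    ultimately show ?thesis using u0 by simp
  next
    case False
    have "convex_on {0..} \<Phi>" "\<Phi> 0 = 0" using \<Phi> by (auto simp: orlicz_function_def)
    then have "\<Phi> ((1 - u0 / u) *\<^sub>R 0 + (u0 / u) *\<^sub>R u) \<le> (1 - u0 / u) * \<Phi> 0 + (u0 / u) * \<Phi> u"
      using False u0 by (intro convex_onD) auto
    then have "\<Phi> u0 \<le> (u0 / u) * \<Phi> u" using \<open>\<Phi> 0 = 0\<close> False u0 by simp
    then have "u * (\<Phi> u0 / u0) \<le> \<Phi> u" using False u0 by (simp add: field_simps)
    moreover have "u * v \<le> u * (\<Phi> u0 / u0)"
      using that by (intro mult_left_mono) (auto simp: v_def)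
    ultimately show ?thesis using \<open>w > 0\<close> by linarith
  qed
  then have "orlicz_conj \<Phi> v \<le> ereal w"
    unfolding orlicz_conj_def by (intro SUP_least) auto
  moreover have "v > 0" using u0 \<open>w > 0\<close> by (simp add: v_def)
  ultimately show ?thesis by (rule that[rotated])
qed

text \<open>
  The budget 1 is split among all indices: an enumeration of the integers assigns to the index
  enumerated at place \<open>n\<close> the share \<open>2\<^bsup>-n-1\<^esup>\<close>.
\<close>

lemma Gamma_set_nonempty:
  assumes M: "\<And>k. orlicz_function (M k)"
  shows "Gamma_set M \<noteq> {}"
proof -
  define w :: "int \<Rightarrow> real" where "w k = (1/2) ^ Suc (to_nat k)" for k
  have "\<exists>v>0. orlicz_conj (M k) v \<le> ereal (w k)" for k
    by (rule orlicz_conj_small[OF M[of k], of "w k"]) (auto simp: w_def)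
  then obtain \<gamma> where \<gamma>: "\<And>k. \<gamma> k > 0" "\<And>k. orlicz_conj (M k) (\<gamma> k) \<le> ereal (w k)"
    by metis
  have "(\<Sum>k\<in>F. orlicz_conj (M k) (\<gamma> k)) \<le> 1" if "finite F" for F
  proof -
    have "(\<Sum>k\<in>F. orlicz_conj (M k) (\<gamma> k)) \<le> (\<Sum>k\<in>F. ereal (w k))"
      by (intro sum_mono \<gamma>)
    also have "\<dots> = ereal (\<Sum>k\<in>F. w k)" by simp
    also have "(\<Sum>k\<in>F. w k) = (\<Sum>n\<in>to_nat ` F. (1/2) ^ Suc n)"
      by (simp add: sum.reindex w_def)
    also have "\<dots> \<le> (\<Sum>n. (1/2) ^ Suc n)"
      using that power_half_series by (intro sum_le_suminf) (auto simp: sums_iff)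
    also have "\<dots> = 1" using power_half_series by (simp add: sums_iff)
    finally show ?thesis by (simp add: one_ereal_def)
  qed
  then have "(\<Sum>\<^sub>\<infinity>k. orlicz_conj (M k) (\<gamma> k)) \<le> 1"
    by (subst nonneg_infsum_complete) (auto intro!: SUP_least orlicz_conj_nonneg M)
  with \<gamma>(1) have "\<gamma> \<in> Gamma_set M" by (simp add: Gamma_set_def)
  then show ?thesis by blast
qed

lemma Gamma_set_bounded:
  assumes M: "\<And>k. orlicz_function (M k)" and \<gamma>: "\<gamma> \<in> Gamma_set M"
  shows "\<gamma> j \<le> 1 + M j 1"
proof -
  have "ereal (1 * \<gamma> j - M j 1) \<le> orlicz_conj (M j) (\<gamma> j)"
    unfolding orlicz_conj_def by (rule SUP_upper) simp
  also have "\<dots> = (\<Sum>k\<in>{j}. orlicz_conj (M k) (\<gamma> k))" by simp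
  also have "\<dots> \<le> (\<Sum>\<^sub>\<infinity>k. orlicz_conj (M k) (\<gamma> k))"
    unfolding nonneg_infsum_complete[OF orlicz_conj_nonneg[OF M]] by (rule SUP_upper) simp
  also have "\<dots> \<le> 1" using \<gamma> by (simp add: Gamma_set_def)
  finally show ?thesis by (simp add: one_ereal_def)
qed

section \<open>Exponents, the norm and the kernel of the modulus\<close>

lemma exponent_sequence_nat:
  assumes lam: "exponent_sequence lam"
  shows "filterlim (\<lambda>n. lam (int n)) at_top sequentially"
    and "strict_mono (\<lambda>n. lam (int n))"
proof -
  have "filterlim lam at_top at_top" using lam by (simp add: exponent_sequence_def)
  then show "filterlim (\<lambda>n. lam (int n)) at_top sequentially"
    by (rule filterlim_compose) (rule filterlim_int_sequentially)
  have "lam (int n) < lam (int (Suc n))" for n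
  proof (cases n)
    case 0
    then show ?thesis using lam by (simp add: exponent_sequence_def)
  next
    case (Suc m)
    then have "1 \<le> int n" by simp
    then have "lam (int n) < lam (int n + 1)" using lam by (auto simp: exponent_sequence_def)
    then show ?thesis by (simp add: add.commute)
  qed
  then show "strict_mono (\<lambda>n. lam (int n))" by (simp add: strict_mono_Suc_iff)
qed

lemma exponent_sequence_eq_1_iff:
  assumes lam: "exponent_sequence lam"
  shows "lam k = lam 1 \<longleftrightarrow> k = 1"
proof (cases "k \<ge> 0")
  case True
  then obtain n where "k = int n" using nonneg_int_cases by blast
  then show ?thesis
    using strict_mono_eq[OF exponent_sequence_nat(2)[OF lam], of n 1] by simp
next
  case False
  \<comment> \<open>a negative index has a negative exponent\<close>
  have neg: "lam k = - lam (- k)"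
    using lam unfolding exponent_sequence_def by (metis minus_minus)
  have pos: "\<forall>j\<ge>1. lam j > 0" using lam by (auto simp: exponent_sequence_def)
  have "lam (- k) > 0" "lam 1 > 0" using pos False by auto
  with neg False show ?thesis by auto
qed

lemma BS_norm_nonneg:
  assumes "Gamma_set M \<noteq> {}"
  shows "0 \<le> BS_norm lam M f"
proof -
  obtain \<gamma> where \<gamma>: "\<gamma> \<in> Gamma_set M" using assms by blast
  then have "0 \<le> (\<Sum>\<^sub>\<infinity>k. ereal (\<gamma> k * cmod (fourier_coeff f (lam k))))"
    by (intro infsum_nonneg) (simp add: Gamma_set_def less_imp_le)
  also have "\<dots> \<le> BS_norm lam M f"
    unfolding BS_norm_def using \<gamma> by (rule SUP_upper)
  finally show ?thesis .
qed

lemma infsum_single_term: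
  fixes g :: "'a \<Rightarrow> 'b::{comm_monoid_add, t2_space}"
  assumes "\<And>k. k \<noteq> i \<Longrightarrow> g k = 0"
  shows "(\<Sum>\<^sub>\<infinity>k. g k) = g i"
proof -
  have "infsum g UNIV = infsum g {i}"
    using assms by (intro infsum_cong_neutral) auto
  then show ?thesis by simp
qed

text \<open>
  The quotient \<open>\<phi>\<^sub>\<alpha>(t) / t\<^sup>\<alpha>\<close> is the power \<open>\<alpha>/2\<close> of \<open>2 (1 - cos t) / t\<^sup>2\<close>, which tends
  to 1.
\<close>

lemma phi_asymp:
  fixes \<alpha> c :: real
  assumes "\<alpha> > 0" "c < 1"
  shows "\<forall>\<^sub>F t in at_right 0. c * t powr \<alpha> < phi \<alpha> t"
proof -
  have lim: "((\<lambda>t::real. 2 * (1 - cos t) / t\<^sup>2) \<longlongrightarrow> 1) (at_right 0)" by real_asymp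
  have "((\<lambda>t. (2 * (1 - cos t) / t\<^sup>2) powr (\<alpha>/2)) \<longlongrightarrow> 1 powr (\<alpha>/2)) (at_right 0)"
    by (intro tendsto_powr lim tendsto_const) auto
  then have "\<forall>\<^sub>F t in at_right 0. (2 * (1 - cos t) / t\<^sup>2) powr (\<alpha>/2) > c"
    using assms by (intro order_tendstoD) auto
  then show ?thesis
    using eventually_at_right_less[of 0]
  proof eventually_elim
    case (elim t)
    have "t\<^sup>2 powr (\<alpha>/2) = t powr \<alpha>"
      using elim(2) by (simp add: powr_powr flip: powr_numeral)
    then have "c < phi \<alpha> t / t powr \<alpha>"
      using elim by (simp add: phi_def powr_divide flip: powr_mult)
    then show ?case using elim(2) by (simp add: field_simps)
  qed
qed

section \<open>The extremal harmonic\<close>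

theorem mainTheorem4:
  fixes lam :: "int \<Rightarrow> real" and M :: "int \<Rightarrow> real \<Rightarrow> real" and \<alpha> :: real
  assumes "exponent_sequence lam"
    and "\<And>k. orlicz_function (M k)"
    and "\<alpha> > 0"
  shows "\<forall>\<epsilon>>0. \<exists>f \<in> BS_space lam M. \<exists>n0::nat. \<forall>n::nat. n > n0 \<longrightarrow>
    modulus lam M \<alpha> f (pi / lam (int n)) >
      ereal ((pi powr \<alpha> - \<epsilon>) / lam (int n) powr \<alpha>) *
        (\<Sum>\<nu>=1..n. ereal (lam (int \<nu>) powr \<alpha> - lam (int \<nu> - 1) powr \<alpha>)
                     * best_approx lam M (lam (int \<nu>)) f)"
proof (intro allI impI)
  fix \<epsilon> :: real assume "\<epsilon> > 0"
  note lam = assms(1) and M = assms(2)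
  have lam1: "lam 1 > 0" and lam0: "lam 0 = 0" using lam by (auto simp: exponent_sequence_def)
  define f where "f = (\<lambda>x. 1 * exp (\<i> * complex_of_real (lam 1 * x)))"
  have coeff: "fourier_coeff f l = (if l = lam 1 then 1 else 0)" for l
    unfolding f_def by (rule fourier_coeff_harmonic)
  have zero_space: "(\<lambda>_. 0) \<in> B_ap_space lam"
    using B_ap_harmonic[of 0 0]
    by (auto simp: B_ap_space_def fourier_exponents_def fourier_coeff_zero)
  have f_space: "f \<in> B_ap_space lam"
    using B_ap_harmonic[of 1 "lam 1", folded f_def]
    by (auto simp: B_ap_space_def fourier_exponents_def coeff)

  obtain \<gamma>0 where \<gamma>0: "\<gamma>0 \<in> Gamma_set M" using Gamma_set_nonempty[of M, OF M] by blast
  have norm_f: "BS_norm lam M f = (SUP \<gamma>\<in>Gamma_set M. ereal (\<gamma> 1))"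
    unfolding BS_norm_def
  proof (rule SUP_cong[OF refl])
    fix \<gamma>
    show "(\<Sum>\<^sub>\<infinity>k. ereal (\<gamma> k * cmod (fourier_coeff f (lam k)))) = ereal (\<gamma> 1)"
      by (subst infsum_single_term[where i = 1])
         (auto simp: coeff exponent_sequence_eq_1_iff[OF lam] zero_ereal_def)
  qed
  have "BS_norm lam M f \<le> ereal (1 + M 1 1)"
    unfolding norm_f using Gamma_set_bounded[of M, OF M] by (auto intro!: SUP_least)
  moreover have "ereal (\<gamma>0 1) \<le> BS_norm lam M f"
    unfolding norm_f using \<gamma>0 by (rule SUP_upper)
  moreover have "\<gamma>0 1 > 0" using \<gamma>0 by (simp add: Gamma_set_def)
  ultimately obtain N where N: "BS_norm lam M f = ereal N" "N > 0"
    by (cases "BS_norm lam M f") auto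
  have f_BS: "f \<in> BS_space lam M" using f_space N by (simp add: BS_space_def)

  have approx_nonneg: "0 \<le> best_approx lam M \<sigma> f" for \<sigma>
    unfolding best_approx_def
    by (intro INF_greatest BS_norm_nonneg Gamma_set_nonempty[of M, OF M])
  have approx_1: "best_approx lam M \<sigma> f \<le> ereal N" for \<sigma>
    unfolding best_approx_def
    by (rule INF_lower2[of "\<lambda>_. 0"])
       (auto simp: zero_space N fourier_exponents_def fourier_coeff_zero)
  have approx_gt: "best_approx lam M (lam (int \<nu>)) f = 0" if "\<nu> \<ge> 2" for \<nu>
  proof -
    have "lam (int 1) < lam (int \<nu>)"
      using that by (intro strict_monoD[OF exponent_sequence_nat(2)[OF lam]]) simp
    then have "f \<in> {g \<in> B_ap_space lam. fourier_exponents g \<subseteq> {- lam (int \<nu>)<..<lam (int \<nu>)}}"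
      using f_space lam1 by (auto simp: fourier_exponents_def coeff)
    moreover have "BS_norm lam M (\<lambda>x. f x - f x) \<le> 0"
      by (simp add: BS_norm_def fourier_coeff_zero SUP_least flip: zero_ereal_def)
    ultimately have "best_approx lam M (lam (int \<nu>)) f \<le> 0"
      unfolding best_approx_def by (rule INF_lower2[where f = "\<lambda>g. BS_norm lam M (\<lambda>x. f x - g x)"])
    then show ?thesis using approx_nonneg by (rule antisym)
  qed

  define S where "S n = (\<Sum>\<nu>=1..n. ereal (lam (int \<nu>) powr \<alpha> - lam (int \<nu> - 1) powr \<alpha>)
                     * best_approx lam M (lam (int \<nu>)) f)" for n :: nat
  have S: "0 \<le> S n \<and> S n \<le> ereal (lam 1 powr \<alpha> * N)" if "n \<ge> 1" for n
  proof -
    have "S n = (\<Sum>\<nu>\<in>{1}. ereal (lam (int \<nu>) powr \<alpha> - lam (int \<nu> - 1) powr \<alpha>)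
                     * best_approx lam M (lam (int \<nu>)) f)"
      unfolding S_def using that approx_gt by (intro sum.mono_neutral_right) auto
    also have "\<dots> = ereal (lam 1 powr \<alpha>) * best_approx lam M (lam 1) f"
      by (simp add: lam0)
    finally have eq: "S n = \<dots>" .
    have "\<dots> \<le> ereal (lam 1 powr \<alpha>) * ereal N"
      by (intro ereal_mult_left_mono approx_1) simp
    then show ?thesis using approx_nonneg eq by simp
  qed

  have modulus_ge: "ereal (phi \<alpha> (lam 1 * h) * N) \<le> modulus lam M \<alpha> f h" if "h \<ge> 0" for h
  proof -
    have phi: "phi \<alpha> t \<ge> 0" for t by (simp add: phi_def)
    have "ereal (phi \<alpha> (lam 1 * h)) * ereal N
        = (SUP \<gamma>\<in>Gamma_set M. ereal (phi \<alpha> (lam 1 * h)) * ereal (\<gamma> 1))"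
      unfolding N(1)[symmetric] norm_f using \<gamma>0 phi
      by (intro SUP_ereal_mult_left[symmetric]) (auto simp: Gamma_set_def less_imp_le)
    also have "\<dots> = (SUP \<gamma>\<in>Gamma_set M.
        \<Sum>\<^sub>\<infinity>k. ereal (\<gamma> k * phi \<alpha> (lam k * h) * cmod (fourier_coeff f (lam k))))"
    proof (rule SUP_cong[OF refl])
      fix \<gamma> :: "int \<Rightarrow> real"
      show "ereal (phi \<alpha> (lam 1 * h)) * ereal (\<gamma> 1)
        = (\<Sum>\<^sub>\<infinity>k. ereal (\<gamma> k * phi \<alpha> (lam k * h) * cmod (fourier_coeff f (lam k))))"
        by (subst infsum_single_term[where i = 1])
           (auto simp: coeff exponent_sequence_eq_1_iff[OF lam] zero_ereal_def mult.commute)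
    qed
    also have "\<dots> \<le> modulus lam M \<alpha> f h"
      unfolding modulus_def using that by (intro SUP_upper) auto
    finally show ?thesis by simp
  qed

  \<comment> \<open>for \<open>\<epsilon> > \<pi>\<^sup>\<alpha>\<close> the constant is negative; truncating it at 0 keeps multiplication by it monotone\<close>
  define c where "c = max (pi powr \<alpha> - \<epsilon>) 0"
  have "c < pi powr \<alpha>" using \<open>\<epsilon> > 0\<close> by (simp add: c_def)
  then have "c / pi powr \<alpha> < 1" by simp
  note phi_ev = phi_asymp[OF assms(3) this]
  have lim: "filterlim (\<lambda>n. lam (int n)) at_top sequentially"
    by (rule exponent_sequence_nat(1)[OF lam])
  have "filterlim (\<lambda>y. lam 1 * (pi / y)) (at_right 0) at_top"
    using lam1 by real_asymp
  then have "filterlim (\<lambda>n. lam 1 * (pi / lam (int n))) (at_right 0) sequentially"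
    using lim by (rule filterlim_compose)
  then have "\<forall>\<^sub>F n in sequentially. c / pi powr \<alpha> * (lam 1 * (pi / lam (int n))) powr \<alpha>
      < phi \<alpha> (lam 1 * (pi / lam (int n)))"
    using phi_ev by (rule eventually_compose_filterlim[rotated])
  then obtain n0 where n0: "\<And>n. n \<ge> n0 \<Longrightarrow>
      c / pi powr \<alpha> * (lam 1 * (pi / lam (int n))) powr \<alpha> < phi \<alpha> (lam 1 * (pi / lam (int n)))"
    unfolding eventually_sequentially by blast

  have "ereal ((pi powr \<alpha> - \<epsilon>) / lam (int n) powr \<alpha>) * S n < modulus lam M \<alpha> f (pi / lam (int n))"
    if "n > n0" for n
  proof -
    have n: "n \<ge> 1" "n \<ge> n0" using that by auto
    have lamn: "lam (int n) > 0"
      using strict_monoD[OF exponent_sequence_nat(2)[OF lam], of 0 n] n lam0 by simp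
    have "ereal ((pi powr \<alpha> - \<epsilon>) / lam (int n) powr \<alpha>) * S n
        \<le> ereal (c / lam (int n) powr \<alpha>) * S n"
      using S[OF n(1)] by (intro ereal_mult_right_mono) (auto simp: c_def divide_right_mono)
    also have "\<dots> \<le> ereal (c / lam (int n) powr \<alpha>) * ereal (lam 1 powr \<alpha> * N)"
      using S[OF n(1)] by (intro ereal_mult_left_mono) (auto simp: c_def)
    also have "\<dots> = ereal (c / pi powr \<alpha> * (lam 1 * (pi / lam (int n))) powr \<alpha> * N)"
      using lamn lam1 by (simp add: powr_mult powr_divide)
    also have "\<dots> < ereal (phi \<alpha> (lam 1 * (pi / lam (int n))) * N)"
      using mult_strict_right_mono[OF n0[OF n(2)] N(2)] by simp
    also have "\<dots> \<le> modulus lam M \<alpha> f (pi / lam (int n))"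
      using lamn by (intro modulus_ge) simp
    finally show ?thesis .
  qed
  with f_BS show "\<exists>f \<in> BS_space lam M. \<exists>n0::nat. \<forall>n::nat. n > n0 \<longrightarrow>
    modulus lam M \<alpha> f (pi / lam (int n)) >
      ereal ((pi powr \<alpha> - \<epsilon>) / lam (int n) powr \<alpha>) *
        (\<Sum>\<nu>=1..n. ereal (lam (int \<nu>) powr \<alpha> - lam (int \<nu> - 1) powr \<alpha>)
                     * best_approx lam M (lam (int \<nu>)) f)"
    unfolding S_def by blast
qed

end
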